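(* Let $s\ge2$ and $d\ge1$ be integers, and let $f(\pmb{x})=\sum_{s_1+\dots+s_d=s,\ s_i\in\mathbb{Z}_{\ge0}} f_{s_1,\dots,s_d}x_1^{s_1}\cdots x_d^{s_d}$ be a homogeneous polynomial of degree $s$ with rational coefficients such that the set $\{\pmb{x}\in\mathbb{Q}^d: f(\pmb{x})=0\}$ is finite. Let $\pmb{\xi}\in\mathbb{R}^d\setminus\mathbb{Q}^d$ with $f(\pmb{\xi})=1$. Let $D\in\mathbb{Z}_{>0}$ be the (least positive) common denominator of all the coefficients $f_{s_1,\dots,s_d}$, and let $K=\sup_{\pmb{x}\in\mathbb{R}^d,\ |\pmb{x}|=1}|f(\pmb{x})|$. Then for every $\varepsilon>0$ there exist arbitrarily large $T$ such that $T^{s-1}\cdot\Psi_{f,\pmb{\xi}}(T)\ge \frac{1}{2^sDK}-\varepsilon$.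
   Context: $|\cdot|$ denotes the Euclidean norm. For $T\ge1$, $\Psi_{f,\pmb{\xi}}(T)=\min\frac{|q\pmb{\xi}-\pmb{a}|^s}{q}$, the minimum taken over all $(q,\pmb{a})=(q,a_1,\dots,a_d)\in\mathbb{Z}^{d+1}$ with $1\le q\le T$ and $f(a_1/q,\dots,a_d/q)=1$ (with the convention that a minimum over the empty set is $+\infty$). *)

theory Defs
  imports "HOL-Analysis.Analysis"
begin

text \<open>The dimension \<open>d\<close> is \<open>CARD('n)\<close>, which is automatically positive.
  Only the values of \<open>c\<close> on multi-indices of weight \<open>s\<close> matter.\<close>

definition multi_indices :: "nat \<Rightarrow> ('n::finite \<Rightarrow> nat) set" where
  "multi_indices s = {\<alpha>. (\<Sum>i\<in>UNIV. \<alpha> i) = s}"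

definition form_eval :: "nat \<Rightarrow> (('n::finite \<Rightarrow> nat) \<Rightarrow> rat) \<Rightarrow> real ^ 'n \<Rightarrow> real" where
  "form_eval s c x = (\<Sum>\<alpha>\<in>multi_indices s. of_rat (c \<alpha>) * (\<Prod>i\<in>UNIV. (x $ i) ^ \<alpha> i))"

definition rational_points :: "(real ^ 'n::finite) set" where
  "rational_points = {x. \<forall>i. x $ i \<in> \<rat>}"

definition common_denom :: "nat \<Rightarrow> (('n::finite \<Rightarrow> nat) \<Rightarrow> rat) \<Rightarrow> nat" where
  "common_denom s c = (LEAST D. D > 0 \<and> (\<forall>\<alpha>\<in>multi_indices s. of_nat D * c \<alpha> \<in> \<int>))"

definition sphere_sup :: "nat \<Rightarrow> (('n::finite \<Rightarrow> nat) \<Rightarrow> rat) \<Rightarrow> real" where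
  "sphere_sup s c = (SUP x\<in>{x::real^'n. norm x = 1}. \<bar>form_eval s c x\<bar>)"

definition int_vec :: "int ^ 'n::finite \<Rightarrow> real ^ 'n" where
  "int_vec a = (\<chi> i. real_of_int (a $ i))"

definition admissible :: "nat \<Rightarrow> (('n::finite \<Rightarrow> nat) \<Rightarrow> rat) \<Rightarrow> real \<Rightarrow> (int \<times> (int ^ 'n)) set" where
  "admissible s c T =
     {(q, a). 1 \<le> q \<and> real_of_int q \<le> T \<and>
        form_eval s c (\<chi> i. real_of_int (a $ i) / real_of_int q) = 1}"

definition approx_err :: "nat \<Rightarrow> real ^ 'n::finite \<Rightarrow> int \<times> (int ^ 'n) \<Rightarrow> real" where
  "approx_err s \<xi> = (\<lambda>(q, a). norm (real_of_int q *\<^sub>R \<xi> - int_vec a) ^ s / real_of_int q)"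

text \<open>The infimum is taken in the extended reals, so that it is \<open>\<infinity>\<close> over the empty set;
  lemma \<open>Psi_attained\<close> below shows that otherwise it is a minimum.\<close>

definition Psi :: "nat \<Rightarrow> (('n::finite \<Rightarrow> nat) \<Rightarrow> rat) \<Rightarrow> real ^ 'n \<Rightarrow> real \<Rightarrow> ereal" where
  "Psi s c \<xi> T = (INF p\<in>admissible s c T. ereal (approx_err s \<xi> p))"

lemma finite_int_vec_bounded: "finite {a :: int ^ 'n::finite. \<forall>i. \<bar>a $ i\<bar> \<le> B}"
proof -
  have "{a :: int ^ 'n. \<forall>i. \<bar>a $ i\<bar> \<le> B} \<subseteq> vec_lambda ` (Pi\<^sub>E UNIV (\<lambda>_. {-B..B}))"
  proof
    fix a :: "int ^ 'n" assume "a \<in> {a. \<forall>i. \<bar>a $ i\<bar> \<le> B}"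
    then have "vec_nth a \<in> Pi\<^sub>E UNIV (\<lambda>_. {-B..B})" by (auto simp: abs_le_iff minus_le_iff)
    then show "a \<in> vec_lambda ` (Pi\<^sub>E UNIV (\<lambda>_. {-B..B}))"
      by (metis image_eqI vec_nth_inverse)
  qed
  moreover have "finite (Pi\<^sub>E (UNIV::'n set) (\<lambda>_. {-B..B}))" by (intro finite_PiE) auto
  ultimately show ?thesis by (meson finite_imageI finite_subset)
qed

lemma Psi_attained:
  assumes "s > 0" and "admissible s c T \<noteq> {}"
  shows "\<exists>p\<in>admissible s c T. Psi s c \<xi> T = ereal (approx_err s \<xi> p) \<and>
           (\<forall>p'\<in>admissible s c T. approx_err s \<xi> p \<le> approx_err s \<xi> p')"
proof -
  let ?A = "admissible s c T" and ?e = "approx_err s \<xi>"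
  obtain p0 where p0: "p0 \<in> ?A" using assms by auto
  let ?B = "{p \<in> ?A. ?e p \<le> ?e p0}"
  define M where "M = max 1 (?e p0 * T)"
  define R where "R = \<lceil>M + T * norm \<xi>\<rceil>"
  have "?B \<subseteq> {1..\<lceil>T\<rceil>} \<times> {a. \<forall>i. \<bar>a $ i\<bar> \<le> R}"
  proof (clarsimp, intro conjI allI)
    fix q a i assume A: "(q, a) \<in> ?A" and e: "?e (q, a) \<le> ?e p0"
    from A have q: "1 \<le> q" "real_of_int q \<le> T" by (auto simp: admissible_def)
    show "1 \<le> q" by fact
    show "q \<le> \<lceil>T\<rceil>" using q by linarith
    let ?v = "real_of_int q *\<^sub>R \<xi> - int_vec a"
    have e0: "0 \<le> ?e p0" using p0 by (auto simp: admissible_def approx_err_def)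
    have "norm ?v ^ s \<le> ?e p0 * real_of_int q"
      using e q by (simp add: approx_err_def divide_le_eq)
    also have "\<dots> \<le> ?e p0 * T" using e0 q by (intro mult_left_mono) auto
    finally have v: "norm ?v ^ s \<le> M" by (simp add: M_def)
    have "norm ?v \<le> M"
    proof (cases "norm ?v \<le> 1")
      case False
      then have "norm ?v ^ 1 \<le> norm ?v ^ s" using assms(1) by (intro power_increasing) auto
      with v show ?thesis by simp
    qed (simp add: M_def)
    moreover have "norm (real_of_int q *\<^sub>R \<xi>) \<le> T * norm \<xi>"
      using q by (auto intro: mult_right_mono)
    moreover have "norm (int_vec a) \<le> norm (real_of_int q *\<^sub>R \<xi>) + norm ?v"
      by (metis norm_minus_commute norm_triangle_sub)
    moreover have "\<bar>int_vec a $ i\<bar> \<le> norm (int_vec a)" by (rule component_le_norm_cart)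
    ultimately have "\<bar>real_of_int (a $ i)\<bar> \<le> M + T * norm \<xi>" by (simp add: int_vec_def)
    then show "\<bar>a $ i\<bar> \<le> R" unfolding R_def by linarith
  qed
  then have fin: "finite ?B"
    by (rule finite_subset) (intro finite_cartesian_product finite_int_vec_bounded, simp)
  have "p0 \<in> ?B" using p0 by simp
  then have ne: "?B \<noteq> {}" by blast
  obtain p where p: "p \<in> ?B" "\<forall>p'\<in>?B. ?e p \<le> ?e p'"
    using ex_is_arg_min_if_finite[OF fin ne, of ?e] by (force simp: is_arg_min_linorder)
  have min: "\<forall>p'\<in>?A. ?e p \<le> ?e p'"
  proof
    fix p' assume "p' \<in> ?A"
    then have "?e p \<le> ?e p'" if "?e p' \<le> ?e p0" using p(2) that by blast
    moreover have "?e p \<le> ?e p0" using p(1) by blast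
    ultimately show "?e p \<le> ?e p'" by linarith
  qed
  moreover have "Psi s c \<xi> T = ereal (?e p)"
    unfolding Psi_def using p min by (intro antisym INF_lower INF_greatest) auto
  ultimately show ?thesis using p by blast
qed

end

(* If (q, a) minimises at T0 and (q', a') is the solution of least denominator beating it, then
   D f(q' a - q a') is an integer: up to multiples of q q' it equals
   D q'^s f(a) + D (-q)^s f(a') = D (q q')^s (1 + (-1)^s), so q q' divides it. It is nonzero:
   by homogeneity f has no nontrivial rational zero, and if q' a = q a' then (q', a') represents the
   same rational point with a larger denominator, hence a larger error. Hence q q' <= D K |q' a - q a'|^s, and the
   right-hand side is at most D K (2 q' |q xi - a|)^s. Letting T tend to q' from below gives the
   bound. *)
theory Submission
  imports Defs
begin

section \<open>Forms\<close>

lemma finite_multi_indices: "finite (multi_indices s :: ('n::finite \<Rightarrow> nat) set)"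
proof (rule finite_subset)
  show "multi_indices s \<subseteq> Pi\<^sub>E (UNIV :: 'n set) (\<lambda>_. {..s})"
  proof
    fix \<alpha> :: "'n \<Rightarrow> nat" assume "\<alpha> \<in> multi_indices s"
    then have "\<alpha> i \<le> s" for i
      using member_le_sum[of i UNIV \<alpha>] by (simp add: multi_indices_def)
    then show "\<alpha> \<in> Pi\<^sub>E UNIV (\<lambda>_. {..s})" by auto
  qed
  show "finite (Pi\<^sub>E (UNIV :: 'n set) (\<lambda>_. {..s}))" by (intro finite_PiE) auto
qed

text \<open>The product of the reduced denominators over the finitely many multi-indices clears
  every coefficient, so the \<open>LEAST\<close> in the definition is attained.\<close>

lemma common_denom:
  fixes c :: "('n::finite \<Rightarrow> nat) \<Rightarrow> rat"
  shows "common_denom s c > 0"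
    and "\<alpha> \<in> multi_indices s \<Longrightarrow> of_nat (common_denom s c) * c \<alpha> \<in> \<int>"
proof -
  let ?den = "\<lambda>\<alpha>. nat (snd (quotient_of (c \<alpha>)))"
  let ?D = "\<Prod>\<alpha>\<in>multi_indices s. ?den \<alpha>"
  have pos: "?den \<alpha> > 0" for \<alpha> using quotient_of_denom_pos' by simp
  have "of_nat ?D * c \<alpha> \<in> \<int>" if "\<alpha> \<in> multi_indices s" for \<alpha>
  proof -
    have "?den \<alpha> dvd ?D" using that finite_multi_indices by (intro dvd_prodI)
    then obtain k where k: "?D = ?den \<alpha> * k" by (elim dvdE)
    have "of_nat (?den \<alpha>) * c \<alpha> = of_int (fst (quotient_of (c \<alpha>)))"
      using pos[of \<alpha>] quotient_of_div[of "c \<alpha>"] by (cases "quotient_of (c \<alpha>)") auto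
    then have "of_nat ?D * c \<alpha> = of_nat k * of_int (fst (quotient_of (c \<alpha>)))"
      unfolding k by (simp add: ac_simps del: of_nat_nat)
    then show ?thesis by (metis Ints_mult Ints_of_int Ints_of_nat)
  qed
  moreover have "?D > 0" using pos by (intro prod_pos) auto
  ultimately have ex: "\<exists>D>0. \<forall>\<alpha>\<in>multi_indices s. of_nat D * c \<alpha> \<in> \<int>" by blast
  have "common_denom s c > 0 \<and> (\<forall>\<alpha>\<in>multi_indices s. of_nat (common_denom s c) * c \<alpha> \<in> \<int>)"
    unfolding common_denom_def using LeastI_ex[OF ex] by simp
  then show "common_denom s c > 0"
    and "\<alpha> \<in> multi_indices s \<Longrightarrow> of_nat (common_denom s c) * c \<alpha> \<in> \<int>" by blast+
qed

lemma form_eval_scaleR: "form_eval s c (r *\<^sub>R x) = r ^ s * form_eval s c x"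
proof -
  have "(\<Prod>i\<in>UNIV. (r * x $ i) ^ \<alpha> i) = r ^ s * (\<Prod>i\<in>UNIV. x $ i ^ \<alpha> i)"
    if "\<alpha> \<in> multi_indices s" for \<alpha>
    using that by (simp add: power_mult_distrib prod.distrib power_sum[symmetric] multi_indices_def)
  then show ?thesis
    by (simp add: form_eval_def sum_distrib_left ac_simps cong: sum.cong)
qed

lemma continuous_on_form_eval: "continuous_on A (form_eval s c)"
  unfolding form_eval_def by (intro continuous_intros)

text \<open>Homogeneity reduces to the unit sphere, whose compactness makes the supremum a genuine
  upper bound; at the origin both sides vanish.\<close>

lemma form_eval_bound: "\<bar>form_eval s c x\<bar> \<le> sphere_sup s c * norm x ^ s"
  if "s > 0" for x :: "real ^ 'n::finite"
proof (cases "x = 0")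
  case True
  then show ?thesis using form_eval_scaleR[of s c 0 x] that by (auto simp: power_0_left)
next
  case False
  let ?S = "{x :: real ^ 'n. norm x = 1}"
  have "compact ((\<lambda>x. \<bar>form_eval s c x\<bar>) ` ?S)"
    using compact_sphere[of "0 :: real ^ 'n" 1]
    by (intro compact_continuous_image continuous_intros continuous_on_form_eval)
       (simp add: sphere_def)
  then have bdd: "bdd_above ((\<lambda>x. \<bar>form_eval s c x\<bar>) ` ?S)"
    by (intro bounded_imp_bdd_above compact_imp_bounded)
  let ?u = "(1 / norm x) *\<^sub>R x"
  have "?u \<in> ?S" using False by simp
  then have "\<bar>form_eval s c ?u\<bar> \<le> sphere_sup s c"
    unfolding sphere_sup_def by (intro cSUP_upper bdd)
  then have "\<bar>form_eval s c ?u\<bar> * norm x ^ s \<le> sphere_sup s c * norm x ^ s"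
    by (intro mult_right_mono) auto
  moreover have "\<bar>form_eval s c ?u\<bar> * norm x ^ s = \<bar>form_eval s c x\<bar>"
    using False by (simp add: form_eval_scaleR abs_mult power_divide)
  ultimately show ?thesis by simp
qed

text \<open>The multiples n x of a nonzero rational zero x are infinitely many rational
  zeros.\<close>

lemma form_eval_rational_zero:
  assumes "s > 0" "finite {x \<in> rational_points. form_eval s c x = 0}"
    and "x \<in> rational_points" "form_eval s c x = 0"
  shows "x = 0"
proof (rule ccontr)
  assume "x \<noteq> 0"
  then have "inj (\<lambda>n::nat. real n *\<^sub>R x)" by (auto intro!: injI)
  moreover have "range (\<lambda>n::nat. real n *\<^sub>R x) \<subseteq> {x \<in> rational_points. form_eval s c x = 0}"
    using assms(3,4) by (auto simp: form_eval_scaleR rational_points_def)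
  ultimately show False
    using assms(2) by (meson finite_subset finite_imageD infinite_UNIV_nat)
qed

section \<open>Divisibility\<close>

text \<open>Expanding the product, every mixed term contains both x and y, so only the two pure
  terms survive modulo x y. In degree 0 the pure terms would be counted twice (1 - 1 - 1), hence the
  positivity assumption.\<close>

lemma dvd_prod_linear_forms:
  fixes A B \<alpha> :: "'i \<Rightarrow> _" and x y :: "'r::comm_ring_1"
  assumes "finite I" "(\<Sum>i\<in>I. \<alpha> i) > 0"
  shows "x * y dvd (\<Prod>i\<in>I. (x * A i + y * B i) ^ \<alpha> i)
           - x ^ (\<Sum>i\<in>I. \<alpha> i) * (\<Prod>i\<in>I. A i ^ \<alpha> i) - y ^ (\<Sum>i\<in>I. \<alpha> i) * (\<Prod>i\<in>I. B i ^ \<alpha> i)"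
proof -
  \<comment> \<open>\<open>E n P a b\<close>: P has degree n and pure coefficients a, b modulo x y.
    Treating degree 0 separately makes the relation multiplicative with a unit, so exponents
    \<alpha> i = 0 cause no trouble in the inductions.\<close>
  define E where "E n P a b \<longleftrightarrow> (if n = 0 then P = 1 \<and> a = 1 \<and> b = 1
      else x * y dvd P - x ^ n * a - y ^ n * b)" for n :: nat and P a b
  have mult: "E (n + m) (P * Q) (a * a') (b * b')" if "E n P a b" "E m Q a' b'"
    for n m P Q a a' b b'
  proof (cases "n = 0 \<or> m = 0")
    case True
    then show ?thesis using that by (auto simp: E_def)
  next
    case False
    then obtain k l where nm: "n = Suc k" "m = Suc l" by (metis not0_implies_Suc)
    from that False obtain u v where
      "P - x ^ n * a - y ^ n * b = x * y * u" "Q - x ^ m * a' - y ^ m * b' = x * y * v"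
      by (auto simp: E_def elim!: dvdE)
    then have "P = x ^ n * a + y ^ n * b + x * y * u" "Q = x ^ m * a' + y ^ m * b' + x * y * v"
      by (simp_all add: algebra_simps)
    \<comment> \<open>Since n, m > 0, the cross terms x^n y^m a b' and y^n x^m b a' each contain x
      y.\<close>
    then have "P * Q - x ^ (n + m) * (a * a') - y ^ (n + m) * (b * b')
        = x * y * (x ^ k * y ^ l * a * b' + y ^ k * x ^ l * b * a'
            + u * Q + v * (x ^ n * a + y ^ n * b))"
      unfolding nm by (simp add: algebra_simps power_add)
    then show ?thesis using False by (simp add: E_def)
  qed
  have E0: "E 0 1 1 1" by (simp add: E_def)
  have E1: "E 1 (x * a + y * b) a b" for a b by (simp add: E_def)
  have pow: "E n ((x * a + y * b) ^ n) (a ^ n) (b ^ n)" for n a b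
    by (induction n) (use mult[OF E1] E0 in auto)
  have "E (\<Sum>i\<in>I. \<alpha> i) (\<Prod>i\<in>I. (x * A i + y * B i) ^ \<alpha> i) (\<Prod>i\<in>I. A i ^ \<alpha> i) (\<Prod>i\<in>I. B i ^ \<alpha> i)"
    using assms(1) by (induction I) (use mult[OF pow] E0 in auto)
  then show ?thesis using assms(2) by (auto simp: E_def)
qed

lemma form_eval_combination_dvd:
  fixes c :: "('n::finite \<Rightarrow> nat) \<Rightarrow> rat" and a a' :: "int ^ 'n" and q q' :: int
  assumes "s > 0"
    and a: "form_eval s c (int_vec a) = of_int q ^ s"
    and a': "form_eval s c (int_vec a') = of_int q' ^ s"
  shows "\<exists>k. real (common_denom s c) * form_eval s c (int_vec (\<chi> i. q' * a $ i - q * a' $ i))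
           = of_int (q * q' * k)"
proof -
  let ?D = "common_denom s c" and ?M = "multi_indices s :: ('n \<Rightarrow> nat) set"
  \<comment> \<open>These floors are exact: e \<alpha> is the integer coefficient of D f, and
    \<open>G\<close> below is D f on integer vectors, with integer values.\<close>
  define e where "e \<alpha> = \<lfloor>of_nat ?D * c \<alpha>\<rfloor>" for \<alpha>
  have e: "real ?D * of_rat (c \<alpha>) = of_int (e \<alpha>)" if "\<alpha> \<in> ?M" for \<alpha>
  proof -
    have "of_int (e \<alpha>) = of_nat ?D * c \<alpha>"
      unfolding e_def using common_denom(2)[OF that] by simp
    then have "(of_rat (of_int (e \<alpha>)) :: real) = of_rat (of_nat ?D * c \<alpha>)" by simp
    then show ?thesis by (simp add: of_rat_mult)
  qed
  define G where "G b = (\<Sum>\<alpha>\<in>?M. e \<alpha> * (\<Prod>i\<in>UNIV. (b $ i) ^ \<alpha> i))" for b :: "int ^ 'n"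
  have G: "real ?D * form_eval s c (int_vec b) = of_int (G b)" for b
    unfolding G_def form_eval_def
    by (simp add: sum_distrib_left mult.assoc[symmetric] e int_vec_def cong: sum.cong)
  have "(of_int (G a) :: real) = of_int (int ?D * q ^ s)" using G[of a] a by simp
  then have Ga: "G a = int ?D * q ^ s" by (simp only: of_int_eq_iff)
  have "(of_int (G a') :: real) = of_int (int ?D * q' ^ s)" using G[of a'] a' by simp
  then have Ga': "G a' = int ?D * q' ^ s" by (simp only: of_int_eq_iff)
  let ?b = "\<chi> i. q' * a $ i - q * a' $ i"
  \<comment> \<open>The expansion lemma is applied monomial by monomial, with x = q' and y =
    -q.\<close>
  have "q' * (- q) dvd G ?b - q' ^ s * G a - (- q) ^ s * G a'"
  proof -
    have "G ?b - q' ^ s * G a - (- q) ^ s * G a' = (\<Sum>\<alpha>\<in>?M. e \<alpha> *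
        ((\<Prod>i\<in>UNIV. (q' * a $ i + (- q) * a' $ i) ^ \<alpha> i)
          - q' ^ s * (\<Prod>i\<in>UNIV. (a $ i) ^ \<alpha> i) - (- q) ^ s * (\<Prod>i\<in>UNIV. (a' $ i) ^ \<alpha> i)))"
      by (simp add: G_def sum_distrib_left sum_subtractf right_diff_distrib ac_simps)
    also have "q' * (- q) dvd \<dots>"
    proof (intro dvd_sum dvd_mult)
      fix \<alpha> :: "'n \<Rightarrow> nat" assume "\<alpha> \<in> ?M"
      then have \<alpha>: "(\<Sum>i\<in>UNIV. \<alpha> i) = s" by (simp add: multi_indices_def)
      show "q' * (- q) dvd (\<Prod>i\<in>UNIV. (q' * a $ i + (- q) * a' $ i) ^ \<alpha> i)
          - q' ^ s * (\<Prod>i\<in>UNIV. (a $ i) ^ \<alpha> i) - (- q) ^ s * (\<Prod>i\<in>UNIV. (a' $ i) ^ \<alpha> i)"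
        using dvd_prod_linear_forms[of UNIV \<alpha> q' "- q" "($) a" "($) a'"] \<alpha> assms(1) by simp
    qed
    finally show ?thesis .
  qed
  \<comment> \<open>Both pure terms equal D (q q')^s up to sign, and s > 0.\<close>
  moreover have "q' * (- q) dvd q' ^ s * G a + (- q) ^ s * G a'"
    using assms(1) by (cases s) (auto simp: Ga Ga' intro!: dvd_add)
  ultimately have "q' * (- q) dvd G ?b"
    using dvd_add by fastforce
  then obtain k where "G ?b = q' * (- q) * k" by (elim dvdE)
  then have "G ?b = q * q' * (- k)" by simp
  then show ?thesis using G[of ?b] by metis
qed

section \<open>Consecutive minima\<close>

lemma admissible_form_eval:
  assumes "(q, a) \<in> admissible s c T"
  shows "form_eval s c (int_vec a) = of_int q ^ s"
proof -
  have q: "q \<ge> 1" and f: "form_eval s c (\<chi> i. real_of_int (a $ i) / real_of_int q) = 1"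
    using assms by (auto simp: admissible_def)
  have "int_vec a = real_of_int q *\<^sub>R (\<chi> i. real_of_int (a $ i) / real_of_int q)"
    using q by (simp add: int_vec_def vec_eq_iff)
  then show ?thesis using f by (simp add: form_eval_scaleR)
qed

lemma approx_err_pos:
  assumes "\<xi> \<notin> rational_points" "q \<ge> 1"
  shows "approx_err s \<xi> (q, a) > 0"
proof -
  have "real_of_int q *\<^sub>R \<xi> \<noteq> int_vec a"
  proof
    assume *: "real_of_int q *\<^sub>R \<xi> = int_vec a"
    have "\<xi> $ i \<in> \<rat>" for i
    proof -
      have "real_of_int q * \<xi> $ i = real_of_int (a $ i)"
        using * by (simp add: int_vec_def vec_eq_iff)
      then have "\<xi> $ i = real_of_int (a $ i) / real_of_int q" using assms(2) by (simp add: field_simps)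
      then show ?thesis by simp
    qed
    then show False using assms(1) by (simp add: rational_points_def)
  qed
  then show ?thesis using assms(2) by (simp add: approx_err_def)
qed

text \<open>Compares two solutions of which the one with the larger or equal denominator is strictly
  better: q q' is at most D K (2 q' |q xi - a|)^s, and dividing by q q' gives the claim.\<close>

lemma approx_err_gap:
  fixes c :: "('n::finite \<Rightarrow> nat) \<Rightarrow> rat" and \<xi> :: "real ^ 'n"
  assumes s: "s \<ge> 2"
    and fin: "finite {x \<in> rational_points. form_eval s c x = 0}"
    and p: "(q, a) \<in> admissible s c T" and p': "(q', a') \<in> admissible s c T'"
    and qq': "q \<le> q'"
    and less: "approx_err s \<xi> (q', a') < approx_err s \<xi> (q, a)"
  shows "1 \<le> 2 ^ s * real (common_denom s c) * sphere_sup s c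
           * (real_of_int q' ^ (s - 1) * approx_err s \<xi> (q, a))"
proof -
  let ?D = "common_denom s c" and ?K = "sphere_sup s c"
  define x y where "x = real_of_int q" and "y = real_of_int q'"
  define v v' where "v = x *\<^sub>R \<xi> - int_vec a" and "v' = y *\<^sub>R \<xi> - int_vec a'"
  obtain t where st: "s = Suc t" using s by (cases s) auto
  have x: "x \<ge> 1" and xy: "x \<le> y" using p qq' by (auto simp: admissible_def x_def y_def)
  have less': "norm v' ^ s / y < norm v ^ s / x"
    using less by (simp add: approx_err_def v_def v'_def x_def y_def)
  \<comment> \<open>Cross-multiplying the error inequality and using x \<le> y yields x |v'| < y
    |v|. This strict inequality serves twice: it excludes b = 0 and it bounds |b|.\<close>
  have "(x * norm v') ^ s = x ^ s * y * (norm v' ^ s / y)"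
    using x xy by (simp add: power_mult_distrib)
  also have "\<dots> < x ^ s * y * (norm v ^ s / x)"
    using x xy less' by (intro mult_strict_left_mono) auto
  also have "\<dots> = x ^ t * y * norm v ^ s" using x by (simp add: st)
  also have "\<dots> \<le> y ^ t * y * norm v ^ s"
    using x xy by (intro mult_right_mono power_mono) auto
  also have "\<dots> = (y * norm v) ^ s" by (simp add: st power_mult_distrib)
  finally have lt: "x * norm v' < y * norm v"
    by (rule power_less_imp_less_base) (use x xy in auto)
  define b where "b = (\<chi> i. q' * a $ i - q * a' $ i)"
  \<comment> \<open>The \<xi> terms cancel, so b is small because both v and v' are.\<close>
  have b: "int_vec b = x *\<^sub>R v' - y *\<^sub>R v"
    by (simp add: b_def int_vec_def v_def v'_def x_def y_def vec_eq_iff algebra_simps)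
  have "b \<noteq> 0"
  proof
    assume "b = 0"
    then have "x *\<^sub>R v' = y *\<^sub>R v" using b by (simp add: int_vec_def vec_eq_iff)
    then have "norm (x *\<^sub>R v') = norm (y *\<^sub>R v)" by simp
    then show False using lt x xy by simp
  qed
  then have "int_vec b \<noteq> 0" by (auto simp: int_vec_def vec_eq_iff)
  moreover have "int_vec b \<in> rational_points" by (simp add: int_vec_def rational_points_def)
  ultimately have "form_eval s c (int_vec b) \<noteq> 0"
    using form_eval_rational_zero[OF _ fin] s by force
  moreover obtain k where k: "real ?D * form_eval s c (int_vec b) = of_int (q * q' * k)"
    using form_eval_combination_dvd[OF _ admissible_form_eval[OF p] admissible_form_eval[OF p']] s
    unfolding b_def by force
  ultimately have "k \<noteq> 0" using common_denom(1)[of s c] by auto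
  then have k1: "1 \<le> \<bar>real_of_int k\<bar>" by linarith
  \<comment> \<open>A nonzero multiple of q q' has absolute value at least q q'.\<close>
  have "x * y * 1 \<le> x * y * \<bar>real_of_int k\<bar>" using x xy k1 by (intro mult_left_mono) auto
  also have "\<dots> = real ?D * \<bar>form_eval s c (int_vec b)\<bar>"
    using arg_cong[OF k, of abs] x xy by (simp add: abs_mult x_def y_def)
  also have "\<dots> \<le> real ?D * (?K * norm (int_vec b) ^ s)"
    using s by (intro mult_left_mono form_eval_bound) auto
  also have "\<dots> \<le> real ?D * (?K * (2 * y * norm v) ^ s)"
  proof (intro mult_left_mono power_mono)
    have "norm (int_vec b) \<le> norm (x *\<^sub>R v') + norm (y *\<^sub>R v)"
      unfolding b by (rule norm_triangle_ineq4)
    then show "norm (int_vec b) \<le> 2 * y * norm v" using lt x xy by simp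
    \<comment> \<open>Evaluating the bound at a unit vector shows K \<ge> 0, as monotonicity
      requires.\<close>
    have "0 \<le> \<bar>form_eval s c (axis undefined 1)\<bar>" by simp
    also have "\<dots> \<le> ?K * norm (axis undefined 1 :: real ^ 'n) ^ s"
      using s by (intro form_eval_bound) auto
    finally show "0 \<le> ?K" by simp
  qed auto
  also have "\<dots> = x * y * (2 ^ s * real ?D * ?K * (y ^ t * (norm v ^ s / x)))"
    using x by (simp add: st power_mult_distrib)
  finally have "1 \<le> 2 ^ s * real ?D * ?K * (y ^ t * (norm v ^ s / x))"
    using x xy by (simp only: mult_le_cancel_left_pos[of "x * y"] mult_pos_pos)
  then show ?thesis by (simp add: st approx_err_def v_def x_def y_def)
qed

theorem mainTheorem7:
  fixes s :: nat
    and c :: "('n::finite \<Rightarrow> nat) \<Rightarrow> rat"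
    and \<xi> :: "real ^ 'n"
    and \<epsilon> :: real
  assumes "s \<ge> 2"
    and "finite {x \<in> rational_points. form_eval s c x = 0}"
    and "\<xi> \<notin> rational_points"
    and "form_eval s c \<xi> = 1"
    and "\<epsilon> > 0"
  shows "\<forall>T0::real. \<exists>T\<ge>T0. T \<ge> 1 \<and>
           ereal (T ^ (s - 1)) * Psi s c \<xi> T
             \<ge> ereal (1 / (2 ^ s * real (common_denom s c) * sphere_sup s c) - \<epsilon>)"
proof (rule ccontr)
  let ?L = "2 ^ s * real (common_denom s c) * sphere_sup s c"
  define C where "C = 1 / ?L"
  assume "\<not> ?thesis"
  then obtain T1 where "\<forall>T\<ge>T1. T \<ge> 1 \<longrightarrow> ereal (T ^ (s - 1)) * Psi s c \<xi> T < ereal (C - \<epsilon>)"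
    unfolding C_def by (meson not_le)
  moreover define T0 where "T0 = max T1 1"
  ultimately have small: "ereal (T ^ (s - 1)) * Psi s c \<xi> T < ereal (C - \<epsilon>)" if "T \<ge> T0" for T
    using that by auto
  have T0: "T0 \<ge> 1" by (simp add: T0_def)
  \<comment> \<open>Since f(\<xi>) = 1, the bound at \<xi> itself forces K > 0, so C is a true
    quotient rather than a division by zero.\<close>
  have "form_eval s c \<xi> \<le> sphere_sup s c * norm \<xi> ^ s"
    using form_eval_bound[of s c \<xi>] assms(1) by simp
  then have "0 < sphere_sup s c" using assms(4) zero_less_mult_pos2[of _ "norm \<xi> ^ s"]
    by (smt (verit, best) mult_nonpos_nonneg norm_ge_zero zero_le_power)
  then have L: "?L > 0" using common_denom(1)[of s c] by simp
  \<comment> \<open>The negated claim in real terms: it applies to any lower bound \<psi> for the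
    errors up to T, and so also covers an empty set of solutions.\<close>
  have bound: "T ^ (s - 1) * \<psi> < C - \<epsilon>"
    if T: "T \<ge> T0" and ge: "\<And>p. p \<in> admissible s c T \<Longrightarrow> \<psi> \<le> approx_err s \<xi> p" for T \<psi>
  proof -
    have "ereal (T ^ (s - 1)) * ereal \<psi> \<le> ereal (T ^ (s - 1)) * Psi s c \<xi> T"
      unfolding Psi_def using ge T T0 by (intro ereal_mult_left_mono INF_greatest) auto
    also have "\<dots> < ereal (C - \<epsilon>)" by (rule small[OF T])
    finally show ?thesis by simp
  qed
  have "admissible s c T0 \<noteq> {}"
  proof
    assume "admissible s c T0 = {}"
    \<comment> \<open>Over the empty set every real is a lower bound; this choice gives C < C -
      \<epsilon>.\<close>
    then have "T0 ^ (s - 1) * (C / T0 ^ (s - 1)) < C - \<epsilon>" by (intro bound) auto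
    then show False using T0 assms(5) by simp
  qed
  then obtain q a where p: "(q, a) \<in> admissible s c T0"
    and min: "\<And>p. p \<in> admissible s c T0 \<Longrightarrow> approx_err s \<xi> (q, a) \<le> approx_err s \<xi> p"
    using Psi_attained[of s c T0 \<xi>] assms(1) by force
  define \<psi> where "\<psi> = approx_err s \<xi> (q, a)"
  have q: "1 \<le> q" "real_of_int q \<le> T0" using p by (auto simp: admissible_def)
  have \<psi>: "\<psi> > 0" unfolding \<psi>_def using approx_err_pos[OF assms(3)] q by blast
  \<comment> \<open>The existential T removes the height restriction, leaving a property of the
    denominator n alone.\<close>
  define Better where "Better n \<longleftrightarrow> (\<exists>T a'. (int n, a') \<in> admissible s c T \<and> approx_err s \<xi> (int n, a') < \<psi>)"
    for n
  have BetterI: "Better (nat r)" "real_of_int r \<le> T"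
    if "(r, d) \<in> admissible s c T" "approx_err s \<xi> (r, d) < \<psi>" for r d T
  proof -
    have "1 \<le> r" "real_of_int r \<le> T" using that(1) by (auto simp: admissible_def)
    then show "Better (nat r)" "real_of_int r \<le> T" using that by (auto simp: Better_def)
  qed
  have "\<exists>n. Better n"
  proof (rule ccontr)
    assume none: "\<not> (\<exists>n. Better n)"
    \<comment> \<open>If nothing ever beat \<psi>, it would stay a lower bound for all T, while
      T^(s-1) \<psi> \<ge> T \<psi> \<ge> C once T \<ge> C / \<psi>; here s \<ge> 2 is used.\<close>
    define T where "T = max T0 (C / \<psi>)"
    have "T ^ (s - 1) * \<psi> < C - \<epsilon>"
      using none BetterI(1) by (intro bound) (auto simp: T_def not_less[symmetric])
    moreover have "C \<le> T * \<psi>"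
      using \<psi> by (simp add: T_def pos_divide_le_eq[symmetric])
    moreover have "T ^ 1 \<le> T ^ (s - 1)"
      using T0 assms(1) by (intro power_increasing) (auto simp: T_def)
    then have "T * \<psi> \<le> T ^ (s - 1) * \<psi>" using \<psi> by simp
    ultimately show False using assms(5) by linarith
  qed
  define n where "n = (LEAST n. Better n)"
  have "Better n" unfolding n_def using \<open>\<exists>n. Better n\<close> by (rule LeastI_ex)
  then obtain T' a' where p': "(int n, a') \<in> admissible s c T'"
    and less: "approx_err s \<xi> (int n, a') < \<psi>" by (auto simp: Better_def)
  \<comment> \<open>Minimality of \<psi> at T0 pushes the better solution beyond T0, so the interval
    from T0 to n is nondegenerate.\<close>
  have n: "T0 < real n"
  proof (rule ccontr)
    assume "\<not> T0 < real n"
    then have "(int n, a') \<in> admissible s c T0" using p' by (auto simp: admissible_def)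
    then show False using min less by (force simp: \<psi>_def)
  qed
  have below: "T ^ (s - 1) * \<psi> < C - \<epsilon>" if T: "T0 \<le> T" "T < real n" for T
  proof (rule bound[OF T(1)], rule ccontr)
    fix r assume r: "r \<in> admissible s c T" "\<not> \<psi> \<le> approx_err s \<xi> r"
    obtain m d where md: "r = (m, d)" by (cases r)
    have "Better (nat m)" "real_of_int m \<le> T" using BetterI[of m d T] r md by auto
    moreover have "n \<le> nat m" unfolding n_def using calculation(1) by (rule Least_le)
    moreover have "1 \<le> m" using r md by (auto simp: admissible_def)
    ultimately show False using T(2) by linarith
  qed
  \<comment> \<open>At T = n the error \<psi> has just been beaten, so \<open>bound\<close> is
    usable only for T < n; the left limit recovers the endpoint with a weak inequality, which
    \<epsilon> > 0 can afford.\<close>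
  have "real n ^ (s - 1) * \<psi> \<le> C - \<epsilon>"
  proof (rule tendsto_upperbound)
    show "((\<lambda>T. T ^ (s - 1) * \<psi>) \<longlongrightarrow> real n ^ (s - 1) * \<psi>) (at_left (real n))"
      by (intro tendsto_intros)
    show "\<forall>\<^sub>F T in at_left (real n). T ^ (s - 1) * \<psi> \<le> C - \<epsilon>"
      using eventually_at_left_real[OF n]
      by (rule eventually_mono) (use below in \<open>simp add: less_imp_le\<close>)
  qed simp
  \<comment> \<open>The gap lemma applies because q \<le> T0 < n.\<close>
  moreover have "1 \<le> ?L * (real n ^ (s - 1) * \<psi>)"
    using approx_err_gap[OF assms(1,2) p p'] less n q by (simp add: \<psi>_def)
  then have "C \<le> real n ^ (s - 1) * \<psi>"
    using L by (simp add: C_def pos_divide_le_eq mult.commute)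
  ultimately show False using assms(5) by linarith
qed

end
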